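(* As formal power series in $q$ (equivalently, for complex $q$ with $|q|<1$), $$\sum_{n\ge 0}\frac{q^{n^2}}{(q;q)_{2n}}=\frac{1}{(q;q)_\infty}\sum_{k\in\mathbb{Z}}\left(q^{15k^2+k}-q^{15k^2+11k+2}\right).$$
   Context: $(q;q)_n=\prod_{j=1}^{n}(1-q^j)$ and $(q;q)_\infty=\prod_{j\ge1}(1-q^j)$. *)

theory Defs
  imports "HOL-Analysis.Analysis"
begin

text \<open>
  The \<open>q\<close>-factorials $(q;q)_n$ and $(q;q)_\infty$. They are polymorphic, so that \<open>q\<close> can be the
  indeterminate \<open>fps_X\<close> as well as a complex number; for formal power series the infinite product
  is taken in the \<open>X\<close>-adic topology.
\<close>

definition qpoch :: "'a::comm_ring_1 \<Rightarrow> nat \<Rightarrow> 'a" where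
  "qpoch q n = (\<Prod>j=1..n. 1 - q ^ j)"

definition qpoch_inf :: "'a::{t2_space, comm_ring_1} \<Rightarrow> 'a" where
  "qpoch_inf q = (\<Prod>j. 1 - q ^ Suc j)"

text \<open>
  The exponents of the theta series are nonnegative for every integer \<open>k\<close>, so converting them
  with \<open>nat\<close> does not truncate.
\<close>

lemma theta_exponents_bound:
  fixes k :: int
  shows "\<bar>k\<bar> \<le> 15*k^2 + k" "\<bar>k\<bar> \<le> 15*k^2 + 11*k + 2"
proof -
  have *: "\<bar>k\<bar> \<le> k^2"
  proof (cases "k = 0")
    case False
    then have "\<bar>k\<bar> * 1 \<le> \<bar>k\<bar> * \<bar>k\<bar>" by (intro mult_left_mono) auto
    then show ?thesis by (simp add: power2_eq_square)
  qed auto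
  show "\<bar>k\<bar> \<le> 15*k^2 + k" "\<bar>k\<bar> \<le> 15*k^2 + 11*k + 2" using * by linarith+
qed

text \<open>
  The infinite product and the sum over the integers do converge, both for formal power series
  and for complex \<open>q\<close> in the open unit disc, so neither takes an arbitrary default value.
\<close>

lemma convergent_prod_qpoch_inf_fps:
  "convergent_prod (\<lambda>j. 1 - (fps_X :: 'a::field fps) ^ Suc j)"
proof -
  define f where "f = (\<lambda>n. \<Prod>j\<le>n. 1 - (fps_X :: 'a fps) ^ Suc j)"
  have step: "fps_nth (f (Suc n)) i = fps_nth (f n) i" if "i \<le> n" for n i
  proof -
    have "f (Suc n) = f n - f n * fps_X ^ Suc (Suc n)"
      by (simp add: f_def right_diff_distrib del: power_Suc)
    then show ?thesis using that by (simp add: fps_X_power_mult_right_nth del: power_Suc)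
  qed
  have stab: "fps_nth (f (i + d)) i = fps_nth (f i) i" for i d
    by (induction d) (auto simp: step)
  have lim: "f \<longlonglongrightarrow> Abs_fps (\<lambda>i. fps_nth (f i) i)"
  proof (rule tendsto_fpsI)
    fix i
    show "eventually (\<lambda>n. fps_nth (f n) i = fps_nth (Abs_fps (\<lambda>i. fps_nth (f i) i)) i) sequentially"
      using eventually_ge_at_top[of i]
      by eventually_elim (use stab[of i] in \<open>auto simp: le_iff_add\<close>)
  qed
  have "fps_nth (Abs_fps (\<lambda>i. fps_nth (f i) i)) 0 = 1" by (simp add: f_def)
  then have "Abs_fps (\<lambda>i. fps_nth (f i) i) \<noteq> 0" by (metis fps_zero_nth zero_neq_one)
  with lim have "raw_has_prod (\<lambda>j. 1 - (fps_X :: 'a fps) ^ Suc j) 0 (Abs_fps (\<lambda>i. fps_nth (f i) i))"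
    by (simp add: raw_has_prod_def f_def)
  then show ?thesis unfolding convergent_prod_def by blast
qed

lemma convergent_prod_qpoch_inf_complex:
  fixes q :: complex
  assumes "norm q < 1"
  shows "convergent_prod (\<lambda>j. 1 - q ^ Suc j)"
proof -
  have "summable (\<lambda>j. norm ((1 - q ^ Suc j) - 1))"
    using assms by (simp add: norm_mult norm_power summable_mult summable_geometric)
  then show ?thesis
    by (intro abs_convergent_prod_imp_convergent_prod summable_imp_abs_convergent_prod)
qed

lemma summable_on_theta_fps:
  "(\<lambda>k::int. (fps_X :: 'a::field fps) ^ nat (15*k^2 + k) - fps_X ^ nat (15*k^2 + 11*k + 2))
     summable_on UNIV"
proof -
  define t where "t = (\<lambda>k::int. (fps_X :: 'a fps) ^ nat (15*k^2 + k) - fps_X ^ nat (15*k^2 + 11*k + 2))"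
  have fin: "finite {k\<in>UNIV. fps_nth (t k) n \<noteq> 0}" for n
  proof (rule finite_subset)
    show "{k\<in>UNIV. fps_nth (t k) n \<noteq> 0} \<subseteq> {-int n..int n}"
    proof safe
      fix k :: int
      assume "fps_nth (t k) n \<noteq> 0"
      then have "n = nat (15*k^2 + k) \<or> n = nat (15*k^2 + 11*k + 2)"
        by (auto simp: t_def split: if_splits)
      then have "\<bar>k\<bar> \<le> int n" using theta_exponents_bound[of k] by linarith
      then show "k \<in> {-int n..int n}" by auto
    qed
  qed auto
  have "(t has_sum Abs_fps (\<lambda>n. \<Sum>k | k \<in> UNIV \<and> fps_nth (t k) n \<noteq> 0.
          fps_nth (t k) n)) UNIV"
    by (rule has_sum_fpsI) (use fin in auto)
  then show ?thesis unfolding t_def by (rule has_sum_imp_summable)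
qed

lemma summable_on_theta_complex:
  fixes q :: complex
  assumes "norm q < 1"
  shows "(\<lambda>k::int. q ^ nat (15*k^2 + k) - q ^ nat (15*k^2 + 11*k + 2)) summable_on UNIV"
proof -
  define t where "t = (\<lambda>k::int. q ^ nat (15*k^2 + k) - q ^ nat (15*k^2 + 11*k + 2))"
  define g where "g = (\<lambda>k::int. 2 * norm q ^ nat \<bar>k\<bar>)"
  have geo: "(\<lambda>n. 2 * norm q ^ n) summable_on UNIV"
    using assms by (intro norm_summable_imp_summable_on) (auto simp: norm_power summable_geometric)
  have "g summable_on range int"
    using geo by (subst summable_on_reindex) (auto simp: g_def o_def)
  moreover have "g summable_on range (\<lambda>n. - int n)"
    using geo by (subst summable_on_reindex) (auto simp: g_def o_def inj_def)
  ultimately have "g summable_on range int \<union> range (\<lambda>n. - int n)"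
    by (rule summable_on_union)
  also have "range int \<union> range (\<lambda>n. - int n) = UNIV"
    by (auto simp: image_iff) (metis int_cases2)
  finally have g: "g summable_on UNIV" .
  have "norm (t k) \<le> g k" for k
  proof -
    have "norm (t k) \<le> norm q ^ nat (15*k^2 + k) + norm q ^ nat (15*k^2 + 11*k + 2)"
      unfolding t_def by (metis norm_power norm_triangle_ineq4)
    also have "\<dots> \<le> norm q ^ nat \<bar>k\<bar> + norm q ^ nat \<bar>k\<bar>"
      using assms theta_exponents_bound[of k] by (intro add_mono power_decreasing) auto
    finally show ?thesis by (simp add: g_def)
  qed
  then have "(\<lambda>k. norm (t k)) summable_on UNIV"
    by (intro summable_on_comparison_test[OF g]) auto
  then show ?thesis unfolding t_def by (rule abs_summable_summable)
qed

end

theory Submission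
  imports Defs
begin

text \<open>
  Schur's finite form of the pentagonal number theorem,
  \[ \sum_{j\in\mathbb{Z}} (-1)^j q^{j(3j+1)/2} {N \brack \lfloor (N+3j+1)/2 \rfloor} = 1, \]
  follows by induction on $N$ from the two $q$-Pascal rules, whose correction terms cancel for
  neighbouring $j$. For $N = 2n$ it writes $1/(q;q)_{2n}$ as a combination of the products
  $1/((q;q)_{n+r}(q;q)_{n-r})$; this is the Bailey pair $\beta_n = 1/(q;q)_{2n}$ relative to $1$.
  The $q$-Vandermonde sum gives
  \[ \sum_n \frac{q^{n^2}}{(q;q)_{N-n}(q;q)_{n-r}(q;q)_{n+r}} = \frac{q^{r^2}}{(q;q)_{N-r}(q;q)_{N+r}}, \]
  and combining the two yields an identity between finite sums, valid in every commutative ring in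
  which the $(q;q)_n$ are invertible. Its limit for $N \to \infty$ is the theorem, up to a
  factor $1/(q;q)_\infty$; the limit is justified by Tannery's theorem, which for formal
  power series only requires that the $n$-th term is divisible by $X^n$.
\<close>

section \<open>The finite identity\<close>

lemma sum_int_telescope:
  fixes g :: "int \<Rightarrow> 'b::ab_group_add"
  shows "(\<Sum>k=-int K..int K. g k - g (k - 1)) = g (int K) - g (-int K - 1)"
proof (induction K)
  case (Suc K)
  have "{-int (Suc K)..int (Suc K)} = insert (int (Suc K)) (insert (-int (Suc K)) {-int K..int K})"
    by auto
  moreover have "g (-1 - int K) = g (-int K - 1)"
    by (rule arg_cong) simp
  ultimately show ?case using Suc by simp
qed auto

text \<open>Integer exponents are converted by \<open>nat\<close>, so they may only be added once
  they are known to be nonnegative. Used at k and at -k, this also covers 6k^2 + 5k + 1.\<close>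

lemma schur_exponents_nonneg:
  fixes k :: int
  shows "6*k^2 + k \<ge> 0" "6*k^2 - 5*k + 1 \<ge> 0"
proof -
  have *: "\<bar>k\<bar> \<le> k^2"
    using self_le_power[of "\<bar>k\<bar>" 2] by (cases "k = 0") auto
  then show "6*k^2 + k \<ge> 0" "6*k^2 - 5*k + 1 \<ge> 0" by linarith+
qed

section \<open>Inverse q-factorials and the two q-Pascal rules\<close>

text \<open>The inverses of (q;q)_n are a parameter \<open>u\<close> instead of quotients, so that
  one finite argument serves both formal power series and complex numbers.\<close>

locale qpoch_inverse =
  fixes q :: "'a::comm_ring_1" and u :: "nat \<Rightarrow> 'a"
  assumes qpoch_mult_u: "qpoch q n * u n = 1"
begin

text \<open>
  With the value \<open>0\<close> at negative arguments, the recurrence \<open>rqpoch_rec\<close> holds on all integers, and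
  $q$-binomial coefficients outside their range vanish.
\<close>

definition rqpoch :: "int \<Rightarrow> 'a" where
  "rqpoch m = (if m < 0 then 0 else u (nat m))"

definition qpow :: "int \<Rightarrow> 'a" where
  "qpow m = q ^ nat m"

definition qbinom :: "nat \<Rightarrow> int \<Rightarrow> 'a" where
  "qbinom N m = qpoch q N * rqpoch m * rqpoch (int N - m)"

lemma qpoch_Suc: "qpoch q (Suc n) = qpoch q n * (1 - q ^ Suc n)"
  by (simp add: qpoch_def)

lemma u_0: "u 0 = 1"
  using qpoch_mult_u[of 0] by (simp add: qpoch_def)

lemma u_rec: "(1 - q ^ Suc n) * u (Suc n) = u n"
proof -
  have "(1 - q ^ Suc n) * u (Suc n) = (qpoch q n * u n) * ((1 - q ^ Suc n) * u (Suc n))"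
    by (simp only: qpoch_mult_u mult_1)
  also have "\<dots> = (qpoch q (Suc n) * u (Suc n)) * u n"
    by (simp only: qpoch_Suc mult_ac)
  finally show ?thesis by (simp only: qpoch_mult_u mult_1)
qed

lemma rqpoch_neg [simp]: "m < 0 \<Longrightarrow> rqpoch m = 0"
  by (simp add: rqpoch_def)

lemma rqpoch_of_nat [simp]: "rqpoch (int n) = u n"
  by (simp add: rqpoch_def)

lemma rqpoch_rec: "(1 - qpow m) * rqpoch m = rqpoch (m - 1)"
proof (cases "m > 0")
  case True
  then obtain n where "m = int (Suc n)"
    by (metis gr0_implies_Suc pos_int_cases)
  then show ?thesis
    using u_rec[of n] by (simp add: qpow_def rqpoch_def nat_add_distrib)
\<comment> \<open>For m <= 0 both sides are 0: the truncated power \<open>qpow m\<close> is 1, so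
  the factor on the left vanishes, and m - 1 is negative.\<close>
qed (auto simp: qpow_def rqpoch_def)

lemma qpow_add: "a \<ge> 0 \<Longrightarrow> b \<ge> 0 \<Longrightarrow> qpow (a + b) = qpow a * qpow b"
  by (simp add: qpow_def nat_add_distrib power_add)

lemma qbinom_eq_0: "m < 0 \<or> m > int N \<Longrightarrow> qbinom N m = 0"
  by (auto simp: qbinom_def)

lemma qbinom_0_left: "qbinom 0 m = (if m = 0 then 1 else 0)"
  by (auto simp: qbinom_def rqpoch_def u_0 qpoch_def)

lemma qbinom_sym: "qbinom N (int N - m) = qbinom N m"
  by (simp add: qbinom_def mult_ac)

lemma rqpoch_mult_qbinom: "rqpoch (int N) * qbinom N m = rqpoch m * rqpoch (int N - m)"
proof -
  have "rqpoch (int N) * qbinom N m = (qpoch q N * u N) * (rqpoch m * rqpoch (int N - m))"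
    by (simp only: qbinom_def rqpoch_of_nat mult_ac)
  then show ?thesis by (simp only: qpoch_mult_u mult_1)
qed

text \<open>With r = N + 1 - m, split 1 - q^(N+1) = (1 - q^m) + q^m (1 - q^r). By
  \<open>rqpoch_rec\<close> each bracket is absorbed by one of the two inverse factorials.\<close>

lemma qbinom_Suc: "qbinom (Suc N) m = qbinom N (m - 1) + qpow m * qbinom N m"
proof (cases "0 \<le> m \<and> m \<le> int (Suc N)")
  case True
  let ?r = "int (Suc N) - m"
  have "q ^ Suc N = qpow m * qpow ?r"
    using True qpow_add[of m ?r] by (simp add: qpow_def nat_add_distrib)
  then have "qbinom (Suc N) m = qpoch q N * (1 - qpow m * qpow ?r) * rqpoch m * rqpoch ?r"
    by (simp only: qbinom_def qpoch_Suc)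
  also have "\<dots> = qpoch q N * ((1 - qpow m) * rqpoch m) * rqpoch ?r + qpow m * (qpoch q N * rqpoch m * ((1 - qpow ?r) * rqpoch ?r))"
    by (simp add: algebra_simps)
  also have "\<dots> = qbinom N (m - 1) + qpow m * qbinom N m"
    by (simp only: rqpoch_rec) (simp add: qbinom_def algebra_simps)
  finally show ?thesis .
qed (auto simp: qbinom_eq_0)

text \<open>This is the first Pascal rule reflected by m -> N + 1 - m.\<close>

lemma qbinom_Suc': "qbinom (Suc N) m = qbinom N m + qpow (int N + 1 - m) * qbinom N (m - 1)"
proof -
  have "qbinom (Suc N) m = qbinom (Suc N) (int (Suc N) - m)"
    by (simp only: qbinom_sym)
  also have "\<dots> = qbinom N (int N - m) + qpow (int N + 1 - m) * qbinom N (int N - (m - 1))"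
    by (subst qbinom_Suc) (simp add: algebra_simps)
  finally show ?thesis by (simp only: qbinom_sym)
qed

section \<open>Schur's finite form of the pentagonal number theorem\<close>

text \<open>The Pascal rules produce exponents b that can be negative, where \<open>qpow\<close>
  truncates. This is harmless because the binomial coefficient is then 0.\<close>

lemma qpow_mult_qpow_qbinom:
  assumes "a \<ge> 0" "b \<ge> 0 \<or> m < 0 \<or> m > int N"
  shows "qpow a * (qpow b * qbinom N m) = qpow (a + b) * qbinom N m"
  using assms by (cases "b \<ge> 0") (auto simp: qpow_add qbinom_eq_0 mult.assoc)

text \<open>
  The terms \<open>j = 2k\<close> and \<open>j = 2k - 1\<close> of Schur's sum for \<open>N = 2n\<close> and \<open>N = 2n + 1\<close>.
\<close>

definition schur_even :: "nat \<Rightarrow> int \<Rightarrow> 'a" where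
  "schur_even n k = qpow (6*k^2 + k) * qbinom (2*n) (int n + 3*k)
     - qpow (6*k^2 - 5*k + 1) * qbinom (2*n) (int n + 3*k - 1)"

definition schur_odd :: "nat \<Rightarrow> int \<Rightarrow> 'a" where
  "schur_odd n k = qpow (6*k^2 + k) * qbinom (2*n + 1) (int n + 3*k + 1)
     - qpow (6*k^2 - 5*k + 1) * qbinom (2*n + 1) (int n + 3*k - 1)"

text \<open>Applying one Pascal rule to each of the two binomials leaves the corrections
  \<open>g k\<close> and \<open>g (k - 1)\<close>, whose difference telescopes. The bound n <= K
  puts both boundary values of \<open>g\<close> outside the range of the binomial
  coefficient.\<close>

lemma sum_schur_odd:
  assumes "n \<le> K"
  shows "(\<Sum>k=-int K..int K. schur_odd n k) = (\<Sum>k=-int K..int K. schur_even n k)"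
proof -
  define g where "g k = qpow (6*k^2 + 4*k + int n + 1) * qbinom (2*n) (int n + 3*k + 1)" for k
  have 1: "qpow (6*k^2 + k) * qbinom (2*n + 1) (int n + 3*k + 1)
     = qpow (6*k^2 + k) * qbinom (2*n) (int n + 3*k) + g k" for k
  proof -
    have "qpow (6*k^2 + k) * (qpow (int n + 3*k + 1) * qbinom (2*n) (int n + 3*k + 1)) = g k"
      unfolding g_def by (subst qpow_mult_qpow_qbinom) (use schur_exponents_nonneg[of k] in \<open>auto simp: algebra_simps\<close>)
    then show ?thesis
      using qbinom_Suc[of "2*n" "int n + 3*k + 1"] by (simp add: distrib_left)
  qed
  have 2: "qpow (6*k^2 - 5*k + 1) * qbinom (2*n + 1) (int n + 3*k - 1)
     = qpow (6*k^2 - 5*k + 1) * qbinom (2*n) (int n + 3*k - 1) + g (k - 1)" for k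
  proof -
    have "qpow (6*k^2 - 5*k + 1) * (qpow (int n - 3*k + 2) * qbinom (2*n) (int n + 3*k - 2)) = g (k - 1)"
      unfolding g_def
      by (subst qpow_mult_qpow_qbinom) (use schur_exponents_nonneg[of k] in \<open>auto simp: algebra_simps power2_eq_square\<close>)
    then show ?thesis
      using qbinom_Suc'[of "2*n" "int n + 3*k - 1"] by (simp add: distrib_left algebra_simps)
  qed
  have "schur_odd n k = schur_even n k + (g k - g (k - 1))" for k
    unfolding schur_odd_def schur_even_def 1 2 by (simp add: algebra_simps)
  then have "(\<Sum>k=-int K..int K. schur_odd n k)
      = (\<Sum>k=-int K..int K. schur_even n k) + (g (int K) - g (-int K - 1))"
    by (simp only: sum.distrib sum_int_telescope)
  also have "g (int K) - g (-int K - 1) = 0"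
    using assms by (simp add: g_def qbinom_eq_0)
  finally show ?thesis by simp
qed

lemma schur_even_Suc: "schur_even (Suc n) k = schur_odd n k"
proof -
  let ?h = "qpow (6*k^2 - 2*k + int n + 1) * qbinom (2*n + 1) (int n + 3*k)"
  have 1: "qpow (6*k^2 + k) * qbinom (2 * Suc n) (int (Suc n) + 3*k)
     = qpow (6*k^2 + k) * qbinom (2*n + 1) (int n + 3*k + 1) + ?h"
  proof -
    have "qpow (6*k^2 + k) * (qpow (int n + 1 - 3*k) * qbinom (2*n + 1) (int n + 3*k)) = ?h"
      by (subst qpow_mult_qpow_qbinom) (use schur_exponents_nonneg[of k] in \<open>auto simp: algebra_simps\<close>)
    then show ?thesis
      using qbinom_Suc'[of "2*n + 1" "int n + 3*k + 1"] by (simp add: distrib_left algebra_simps)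
  qed
  have 2: "qpow (6*k^2 - 5*k + 1) * qbinom (2 * Suc n) (int (Suc n) + 3*k - 1)
     = qpow (6*k^2 - 5*k + 1) * qbinom (2*n + 1) (int n + 3*k - 1) + ?h"
  proof -
    have "qpow (6*k^2 - 5*k + 1) * (qpow (int n + 3*k) * qbinom (2*n + 1) (int n + 3*k)) = ?h"
      by (subst qpow_mult_qpow_qbinom) (use schur_exponents_nonneg[of k] in \<open>auto simp: algebra_simps\<close>)
    then show ?thesis
      using qbinom_Suc[of "2*n + 1" "int n + 3*k"] by (simp add: distrib_left)
  qed
  show ?thesis
    unfolding schur_even_def schur_odd_def 1 2 by simp
qed

lemma sum_schur_even: "n \<le> K \<Longrightarrow> (\<Sum>k=-int K..int K. schur_even n k) = 1"
proof (induction n)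
  case 0
  \<comment> \<open>The second binomial never contributes, since 3k - 1 is never 0.\<close>
  have "schur_even 0 k = (if k = 0 then 1 else 0)" for k
    using qbinom_0_left[of "3*k - 1"] by (simp add: schur_even_def qbinom_0_left qpow_def; presburger)
  then show ?case by simp
next
  case (Suc n)
  then show ?case
    by (simp add: schur_even_Suc sum_schur_odd)
qed

text \<open>Replacing k by -k in the second half and reflecting the binomial brings both lower
  entries to the form n + r, with r = 3k and r = 3k + 1, which is the shape that
  \<open>bailey_sum\<close> handles.\<close>

lemma sum_schur:
  assumes "n \<le> K"
  shows "(\<Sum>k=-int K..int K. qpow (6*k^2 + k) * qbinom (2*n) (int n + 3*k)
            - qpow (6*k^2 + 5*k + 1) * qbinom (2*n) (int n + (3*k + 1))) = 1"
proof -
  have *: "(\<Sum>k=-int K..int K. qpow (6*k^2 + 5*k + 1) * qbinom (2*n) (int n + (3*k + 1)))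
     = (\<Sum>k=-int K..int K. qpow (6*k^2 - 5*k + 1) * qbinom (2*n) (int n + 3*k - 1))"
  proof (rule sum.reindex_bij_witness[of _ uminus uminus])
    fix k
    show "qpow (6*(-k)^2 - 5*(-k) + 1) * qbinom (2*n) (int n + 3*(-k) - 1)
      = qpow (6*k^2 + 5*k + 1) * qbinom (2*n) (int n + (3*k + 1))"
      using qbinom_sym[of "2*n" "int n + (3*k + 1)"] by (simp add: algebra_simps)
  qed auto
  show ?thesis
    using sum_schur_even[OF assms] by (simp add: sum_subtractf * schur_even_def)
qed

section \<open>The q-Vandermonde sum and its Bailey form\<close>

text \<open>Induction on M for all a at once. After the Pascal rule, the shifted half is the sum of
  \<open>c\<close>; rewriting u (m + a) by \<open>u_rec\<close> turns the other half into the sum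
  for M and a + 1 minus the same sum of \<open>c\<close>.\<close>

lemma sum_qbinom_mult_u:
  "(\<Sum>m\<le>M. qbinom M (int m) * q ^ (m * (m + a)) * u (m + a)) = u (M + a)"
proof (induction M arbitrary: a)
  case 0
  then show ?case by (simp add: qbinom_0_left)
next
  case (Suc M)
  define c where "c m = qbinom M (int m) * q ^ (Suc m * (m + a + 1)) * u (m + a + 1)" for m
  have a: "qbinom M (int m) * q ^ (m * (m + Suc a)) * u (m + a) =
      qbinom M (int m) * q ^ (m * (m + Suc a)) * u (m + Suc a) - c m" for m
  proof -
    have "u (m + a) = u (m + Suc a) - q ^ (m + a + 1) * u (m + Suc a)"
      using u_rec[of "m + a"] by (simp add: left_diff_distrib)
    moreover have "q ^ (Suc m * (m + a + 1)) = q ^ (m * (m + Suc a)) * q ^ (m + a + 1)"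
      by (simp add: algebra_simps flip: power_add)
    ultimately show ?thesis
      unfolding c_def by (simp add: right_diff_distrib mult_ac)
  qed
  have b: "qpow (int m) * q ^ (m * (m + a)) = q ^ (m * (m + Suc a))" for m
    by (simp add: qpow_def flip: power_add)
  have "(\<Sum>m\<le>Suc M. qbinom (Suc M) (int m) * q ^ (m * (m + a)) * u (m + a))
     = (\<Sum>m\<le>Suc M. qbinom M (int m - 1) * q ^ (m * (m + a)) * u (m + a))
       + (\<Sum>m\<le>Suc M. qbinom M (int m) * (qpow (int m) * q ^ (m * (m + a))) * u (m + a))"
    unfolding qbinom_Suc sum.distrib[symmetric] by (intro sum.cong refl) (simp add: algebra_simps)
  also have "(\<Sum>m\<le>Suc M. qbinom M (int m - 1) * q ^ (m * (m + a)) * u (m + a)) = (\<Sum>m\<le>M. c m)"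
    by (subst sum.atMost_Suc_shift) (simp add: qbinom_eq_0 c_def algebra_simps)
  also have "(\<Sum>m\<le>Suc M. qbinom M (int m) * (qpow (int m) * q ^ (m * (m + a))) * u (m + a))
     = (\<Sum>m\<le>M. qbinom M (int m) * q ^ (m * (m + Suc a)) * u (m + Suc a)) - (\<Sum>m\<le>M. c m)"
    unfolding b by (simp only: sum.atMost_Suc a sum_subtractf) (simp add: qbinom_eq_0 c_def)
  finally show ?case using Suc[of "Suc a"] by simp
qed

text \<open>Terms with n < r vanish. Putting n = m + r and N = M + r, the identity (m + r)^2 = r^2 +
  m (m + 2r) reduces the rest to \<open>sum_qbinom_mult_u\<close> with a = 2r. For r > N both sides
  are 0.\<close>

lemma bailey_sum_of_nat:
  "(\<Sum>n\<le>N. q ^ (n^2) * rqpoch (int N - int n) * (rqpoch (int n + int r) * rqpoch (int n - int r)))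
     = q ^ (r^2) * (rqpoch (int N + int r) * rqpoch (int N - int r))"
proof (cases "r \<le> N")
  case True
  then obtain M where N: "N = r + M"
    using le_Suc_ex by blast
  have "(\<Sum>n\<le>N. q ^ (n^2) * rqpoch (int N - int n) * (rqpoch (int n + int r) * rqpoch (int n - int r)))
     = (\<Sum>n\<in>{r..N}. q ^ (n^2) * rqpoch (int N - int n) * (rqpoch (int n + int r) * rqpoch (int n - int r)))"
    by (rule sum.mono_neutral_right) auto
  also have "\<dots> = (\<Sum>m\<le>M. q ^ ((m + r)^2) * rqpoch (int M - int m) * (rqpoch (int m + 2 * int r) * rqpoch (int m)))"
    by (rule sum.reindex_bij_witness[of _ "\<lambda>m. m + r" "\<lambda>n. n - r"]) (auto simp: N algebra_simps)
  also have "\<dots> = (\<Sum>m\<le>M. q ^ (r^2) * (q ^ (m * (m + 2*r)) * u (m + 2*r) * (rqpoch (int M) * qbinom M (int m))))"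
  proof (rule sum.cong)
    fix m
    have "rqpoch (int m + 2 * int r) = u (m + 2*r)"
      using rqpoch_of_nat[of "m + 2*r"] by simp
    moreover have "q ^ ((m + r)^2) = q ^ (r^2) * q ^ (m * (m + 2*r))"
      by (simp add: power2_eq_square algebra_simps mult_2_right flip: power_add)
    ultimately show "q ^ ((m + r)^2) * rqpoch (int M - int m) * (rqpoch (int m + 2 * int r) * rqpoch (int m))
       = q ^ (r^2) * (q ^ (m * (m + 2*r)) * u (m + 2*r) * (rqpoch (int M) * qbinom M (int m)))"
      by (simp only: rqpoch_mult_qbinom mult_ac)
  qed simp
  also have "\<dots> = q ^ (r^2) * rqpoch (int M) * (\<Sum>m\<le>M. qbinom M (int m) * q ^ (m * (m + 2*r)) * u (m + 2*r))"
    by (simp add: sum_distrib_left mult_ac)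
  also have "\<dots> = q ^ (r^2) * (rqpoch (int N + int r) * rqpoch (int N - int r))"
    unfolding sum_qbinom_mult_u using rqpoch_of_nat[of "M + 2*r"] by (simp add: N algebra_simps)
  finally show ?thesis .
qed (auto intro!: sum.neutral)

text \<open>Both sides are invariant under r -> -r, so the case of natural r suffices.\<close>

lemma bailey_sum:
  fixes r :: int
  shows "(\<Sum>n\<le>N. q ^ (n^2) * rqpoch (int N - int n) * (rqpoch (int n + r) * rqpoch (int n - r)))
     = qpow (r^2) * (rqpoch (int N + r) * rqpoch (int N - r))"
proof (cases r)
  case (nonneg n)
  then show ?thesis
    using bailey_sum_of_nat[of N n] by (simp add: qpow_def nat_power_eq)
next
  case (neg n)
  then show ?thesis
    using bailey_sum_of_nat[of N "Suc n"]
    by (simp add: qpow_def nat_power_eq mult.commute[of "rqpoch (int _ + _)"] del: of_nat_Suc power_Suc)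
qed

section \<open>The identity between finite sums\<close>

text \<open>The exponents arise as 15k^2 + k = (6k^2 + k) + (3k)^2 and 15k^2 + 11k + 2 = (6k^2 + 5k
  + 1) + (3k + 1)^2: Schur's exponent plus the r^2 of \<open>bailey_sum\<close>.\<close>

definition theta_term :: "nat \<Rightarrow> int \<Rightarrow> 'a" where
  "theta_term N k = qpow (15*k^2 + k) * (rqpoch (int N + 3*k) * rqpoch (int N - 3*k))
     - qpow (15*k^2 + 11*k + 2) * (rqpoch (int N + (3*k + 1)) * rqpoch (int N - (3*k + 1)))"

lemma finite_identity:
  "(\<Sum>n\<le>N. q ^ (n^2) * rqpoch (int N - int n) * rqpoch (2 * int n)) = (\<Sum>k=-int N..int N. theta_term N k)"
proof -
  define c where "c n r = rqpoch (int n + r) * rqpoch (int n - r)" for n r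
  \<comment> \<open>Schur's sum is taken with the common cutoff N for every n <= N, so the range of
    k does not depend on n and the two summations can be exchanged.\<close>
  have U2: "rqpoch (2 * int n) = (\<Sum>k=-int N..int N. qpow (6*k^2 + k) * c n (3*k) - qpow (6*k^2 + 5*k + 1) * c n (3*k + 1))"
    if "n \<le> N" for n
  proof -
    have c: "c n r = rqpoch (2 * int n) * qbinom (2*n) (int n + r)" for r
      using rqpoch_mult_qbinom[of "2*n" "int n + r"] by (simp add: c_def algebra_simps)
    have "rqpoch (2 * int n) = rqpoch (2 * int n) * (\<Sum>k=-int N..int N. qpow (6*k^2 + k) * qbinom (2*n) (int n + 3*k)
            - qpow (6*k^2 + 5*k + 1) * qbinom (2*n) (int n + (3*k + 1)))"
      by (simp only: sum_schur[OF that] mult_1_right)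
    then show ?thesis
      by (simp add: c sum_distrib_left algebra_simps)
  qed
  have PP: "qpow (6*k^2 + k) * qpow ((3*k)^2) = qpow (15*k^2 + k)"
    "qpow (6*k^2 + 5*k + 1) * qpow ((3*k + 1)^2) = qpow (15*k^2 + 11*k + 2)" for k
    using schur_exponents_nonneg[of k] schur_exponents_nonneg[of "-k"]
    by (subst qpow_add[symmetric]; simp add: power2_eq_square algebra_simps)+
  have "(\<Sum>n\<le>N. q ^ (n^2) * rqpoch (int N - int n) * rqpoch (2 * int n))
    = (\<Sum>n\<le>N. \<Sum>k=-int N..int N. qpow (6*k^2 + k) * (q ^ (n^2) * rqpoch (int N - int n) * c n (3*k))
         - qpow (6*k^2 + 5*k + 1) * (q ^ (n^2) * rqpoch (int N - int n) * c n (3*k + 1)))"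
  proof (intro sum.cong refl)
    fix n assume "n \<in> {..N}"
    then have "n \<le> N" by simp
    show "q ^ (n^2) * rqpoch (int N - int n) * rqpoch (2 * int n)
      = (\<Sum>k=-int N..int N. qpow (6*k^2 + k) * (q ^ (n^2) * rqpoch (int N - int n) * c n (3*k))
         - qpow (6*k^2 + 5*k + 1) * (q ^ (n^2) * rqpoch (int N - int n) * c n (3*k + 1)))"
      unfolding U2[OF \<open>n \<le> N\<close>] sum_distrib_left by (simp add: right_diff_distrib mult_ac)
  qed
  also have "\<dots> = (\<Sum>k=-int N..int N. \<Sum>n\<le>N. qpow (6*k^2 + k) * (q ^ (n^2) * rqpoch (int N - int n) * c n (3*k))
         - qpow (6*k^2 + 5*k + 1) * (q ^ (n^2) * rqpoch (int N - int n) * c n (3*k + 1)))"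
    by (rule sum.swap)
  also have "\<dots> = (\<Sum>k=-int N..int N. theta_term N k)"
    by (intro sum.cong refl)
       (simp only: sum_subtractf c_def sum_distrib_left[symmetric] bailey_sum theta_term_def
          PP[symmetric], simp only: mult.assoc)
  finally show ?thesis .
qed

end


section \<open>The limit\<close>

instance fps :: (ab_group_add) topological_ab_group_add
proof
  fix a b :: "'a fps"
  show "((\<lambda>x. fst x + snd x) \<longlongrightarrow> a + b) (nhds a \<times>\<^sub>F nhds b)"
  proof (rule tendsto_fpsI)
    fix n
    have "eventually (\<lambda>x. fps_nth x n = fps_nth c n) (nhds c)" for c :: "'a fps"
      using filterlim_ident[of "nhds c"] unfolding tendsto_fps_iff by blast
    then have "eventually (\<lambda>x. fps_nth (fst x) n = fps_nth a n \<and> fps_nth (snd x) n = fps_nth b n)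
        (nhds a \<times>\<^sub>F nhds b)"
      unfolding eventually_prod_filter by fastforce
    then show "eventually (\<lambda>x. fps_nth (fst x + snd x) n = fps_nth (a + b) n) (nhds a \<times>\<^sub>F nhds b)"
      by eventually_elim simp
  qed
  show "(uminus \<longlongrightarrow> - a) (nhds a)"
  proof (rule tendsto_fpsI)
    fix n
    have "eventually (\<lambda>x. fps_nth x n = fps_nth a n) (nhds a)"
      using filterlim_ident[of "nhds a"] unfolding tendsto_fps_iff by blast
    then show "eventually (\<lambda>x. fps_nth (- x) n = fps_nth (- a) n) (nhds a)"
      by eventually_elim simp
  qed
qed

text \<open>The n-th coefficient of a product depends only on the coefficients up to n of the
  factors, and these finitely many coefficients are constant near each point.\<close>

instance fps :: (comm_ring_1) topological_semigroup_mult
proof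
  fix a b :: "'a fps"
  show "((\<lambda>x. fst x * snd x) \<longlongrightarrow> a * b) (nhds a \<times>\<^sub>F nhds b)"
  proof (rule tendsto_fpsI)
    fix n
    have "eventually (\<lambda>x. \<forall>i\<in>{..n}. fps_nth x i = fps_nth c i) (nhds c)" for c :: "'a fps"
      using filterlim_ident[of "nhds c"] unfolding tendsto_fps_iff
      by (subst eventually_ball_finite_distrib) auto
    then have "eventually (\<lambda>x. (\<forall>i\<in>{..n}. fps_nth (fst x) i = fps_nth a i) \<and>
        (\<forall>i\<in>{..n}. fps_nth (snd x) i = fps_nth b i)) (nhds a \<times>\<^sub>F nhds b)"
      unfolding eventually_prod_filter by fastforce
    then show "eventually (\<lambda>x. fps_nth (fst x * snd x) n = fps_nth (a * b) n) (nhds a \<times>\<^sub>F nhds b)"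
      by eventually_elim (simp add: fps_mult_nth)
  qed
qed

section \<open>Limits of q-factorials and of symmetric sums\<close>

text \<open>\<open>convergent_prod\<close> allows finitely many initial factors to be skipped. Since
  no factor vanishes, the offset can be taken as 0, and then the partial products themselves
  converge to the infinite product.\<close>

lemma tendsto_qpoch:
  fixes q :: "'a::{idom, t2_space, topological_semigroup_mult}"
  assumes "convergent_prod (\<lambda>j. 1 - q ^ Suc j)" "\<And>j. 1 - q ^ Suc j \<noteq> 0"
  shows "qpoch q \<longlonglongrightarrow> qpoch_inf q"
proof -
  obtain p where p: "raw_has_prod (\<lambda>j. 1 - q ^ Suc j) 0 p"
    using convergent_prod_offset_0[OF assms] by blast
  then have "qpoch_inf q = p"
    unfolding qpoch_inf_def by (intro has_prod_unique[symmetric]) (simp add: has_prod_def)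
  moreover have "qpoch q (Suc n) = (\<Prod>j\<le>n. 1 - q ^ Suc j)" for n
    unfolding qpoch_def
    by (rule prod.reindex_bij_witness[of _ Suc "\<lambda>j. j - 1"]) auto
  ultimately have "(\<lambda>n. qpoch q (Suc n)) \<longlonglongrightarrow> qpoch_inf q"
    using p by (simp add: raw_has_prod_def)
  then show ?thesis by (rule LIMSEQ_imp_Suc)
qed

text \<open>Pairing k = j with k = -j makes symmetric sums partial sums of an ordinary series, as
  Tannery's theorem requires. For j = 0 the pair is a singleton, so 0 is counted once.\<close>

lemma sum_symmetric_interval:
  fixes f :: "int \<Rightarrow> 'a::comm_monoid_add"
  shows "(\<Sum>k=-int N..int N. f k) = (\<Sum>j\<le>N. \<Sum>k\<in>{int j, -int j}. f k)"
proof (induction N)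
  case (Suc N)
  have "{-int (Suc N)..int (Suc N)} = {-int N..int N} \<union> {int (Suc N), -int (Suc N)}"
    by auto
  then show ?case
    using Suc by (subst sum.atMost_Suc) (simp only:, subst sum.union_disjoint, auto)
qed auto

text \<open>The symmetric intervals eventually contain every finite set of integers, so the limit
  along finite subsets can be taken along them.\<close>

lemma sums_symmetric_infsum:
  fixes f :: "int \<Rightarrow> 'a::{topological_comm_monoid_add, t2_space}"
  assumes "f summable_on UNIV"
  shows "(\<lambda>N. \<Sum>k=-int N..int N. f k) \<longlonglongrightarrow> infsum f UNIV"
proof -
  have "filterlim (\<lambda>N. {-int N..int N}) (finite_subsets_at_top UNIV) sequentially"
    unfolding filterlim_finite_subsets_at_top
  proof safe
    fix X :: "int set"
    assume "finite X"
    then obtain M where M: "\<And>k. k \<in> X \<Longrightarrow> \<bar>k\<bar> \<le> M"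
      by (metis bdd_above_finite bdd_above_def finite_imageI imageI)
    show "eventually (\<lambda>N. finite {-int N..int N} \<and> X \<subseteq> {-int N..int N} \<and> {-int N..int N} \<subseteq> UNIV) sequentially"
      using eventually_ge_at_top[of "nat M"] by eventually_elim (use M in force)
  qed
  moreover have "(sum f \<longlongrightarrow> infsum f UNIV) (finite_subsets_at_top UNIV)"
    using has_sum_infsum[OF assms] by (simp add: has_sum_def)
  ultimately show ?thesis
    by (rule filterlim_compose[rotated])
qed

section \<open>Two versions of Tannery's theorem\<close>

text \<open>For N >= i the i-th coefficient of the sum only sees the terms n <= i, so finitely many
  eventually constant coefficients decide it.\<close>

lemma tannery_fps:
  fixes F :: "nat \<Rightarrow> nat \<Rightarrow> 'a::ab_group_add fps"
  assumes lim: "\<And>n. (\<lambda>N. F N n) \<longlonglongrightarrow> L n"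
    and zero: "\<And>N n i. i < n \<Longrightarrow> fps_nth (F N n) i = 0"
  shows "\<exists>s. L sums s \<and> (\<lambda>N. \<Sum>n\<le>N. F N n) \<longlonglongrightarrow> s"
proof -
  define s where "s = Abs_fps (\<lambda>i. \<Sum>n\<le>i. fps_nth (L n) i)"
  have trunc: "fps_nth (\<Sum>n\<le>N. G n) i = (\<Sum>n\<le>i. fps_nth (G n) i)"
    if "i \<le> N" "\<And>n. i < n \<Longrightarrow> fps_nth (G n) i = 0" for G :: "nat \<Rightarrow> 'a fps" and N i
    unfolding fps_sum_nth by (rule sum.mono_neutral_right) (use that in auto)
  have ev: "eventually (\<lambda>N. fps_nth (F N n) i = fps_nth (L n) i) sequentially" for n i
    using lim unfolding tendsto_fps_iff by blast
  have L0: "fps_nth (L n) i = 0" if "i < n" for n i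
    using eventually_happens[OF ev[of n i]] zero[OF that] by auto
  have "(\<lambda>N. \<Sum>n\<le>N. F N n) \<longlonglongrightarrow> s"
  proof (rule tendsto_fpsI)
    fix i
    have "eventually (\<lambda>N. \<forall>n\<in>{..i}. fps_nth (F N n) i = fps_nth (L n) i) sequentially"
      by (subst eventually_ball_finite_distrib) (auto simp: ev)
    then show "eventually (\<lambda>N. fps_nth (\<Sum>n\<le>N. F N n) i = fps_nth s i) sequentially"
      using eventually_ge_at_top[of i]
    proof eventually_elim
      case (elim N)
      then show ?case using trunc[of i N "F N"] zero by (simp add: s_def)
    qed
  qed
  moreover have "(\<lambda>N. \<Sum>n\<le>N. L n) \<longlonglongrightarrow> s"
  proof (rule tendsto_fpsI)
    fix i
    show "eventually (\<lambda>N. fps_nth (\<Sum>n\<le>N. L n) i = fps_nth s i) sequentially"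
      using eventually_ge_at_top[of i]
      by eventually_elim (use trunc L0 in \<open>simp add: s_def\<close>)
  qed
  ultimately show ?thesis by (auto simp: sums_def_le)
qed

lemma tannery_banach:
  fixes F :: "nat \<Rightarrow> nat \<Rightarrow> 'a::{real_normed_algebra, banach}"
  assumes lim: "\<And>n. (\<lambda>N. F N n) \<longlonglongrightarrow> L n"
    and bound: "\<And>N n. norm (F N n) \<le> M n" and "summable M"
  shows "\<exists>s. L sums s \<and> (\<lambda>N. \<Sum>n\<le>N. F N n) \<longlonglongrightarrow> s"
proof -
  \<comment> \<open>Extending by 0 beyond n = N turns the sum up to N into a full series without
    changing the limit for fixed n.\<close>
  define a where "a n N = (if n \<le> N then F N n else 0)" for n N
  have "M n \<ge> 0" for n
    using bound[of 0 n] norm_ge_zero order_trans by blast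
  then have "norm (a n N) \<le> M n" for n N
    using bound by (simp add: a_def)
  then have bnd: "eventually (\<lambda>(n, N). norm (a n N) \<le> M n) (at_top \<times>\<^sub>F sequentially)"
    by (intro always_eventually) auto
  have "(\<lambda>N. a n N) \<longlonglongrightarrow> L n" for n
  proof (rule Lim_transform_eventually[OF lim])
    show "eventually (\<lambda>N. F N n = a n N) sequentially"
      using eventually_ge_at_top[of n] by eventually_elim (simp add: a_def)
  qed
  from tannerys_theorem[OF this bnd \<open>summable M\<close>]
  have "summable (\<lambda>n. norm (L n))" "(\<lambda>N. \<Sum>n. a n N) \<longlonglongrightarrow> suminf L"
    by auto
  moreover have "(\<Sum>n. a n N) = (\<Sum>n\<le>N. F N n)" for N
    by (subst suminf_finite[of "{..N}"]) (auto simp: a_def)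
  ultimately show ?thesis
    using summable_norm_cancel summable_sums by auto
qed

section \<open>Passage to the limit, for both topologies at once\<close>

locale qpoch_inverse_limit = qpoch_inverse q u
  for q :: "'a::{idom, t2_space, topological_semigroup_mult, topological_ab_group_add}" and u +
  fixes u_inf :: 'a
  assumes u_lim: "u \<longlonglongrightarrow> u_inf"
    and convergent_prod: "convergent_prod (\<lambda>j. 1 - q ^ Suc j)"
begin

text \<open>A vanishing factor would force u n = 0 by \<open>u_rec\<close>, but u n is a
  unit.\<close>

lemma factor_nonzero: "1 - q ^ Suc n \<noteq> 0"
  using u_rec[of n] qpoch_mult_u[of n] by auto

lemma qpoch_inf_mult_u_inf: "qpoch_inf q * u_inf = 1"
proof -
  have "(\<lambda>n. qpoch q n * u n) \<longlonglongrightarrow> qpoch_inf q * u_inf"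
    by (intro tendsto_mult tendsto_qpoch u_lim convergent_prod factor_nonzero)
  then show ?thesis
    by (simp add: qpoch_mult_u LIMSEQ_const_iff)
qed

lemma tendsto_rqpoch_add: "(\<lambda>N. rqpoch (int N + r)) \<longlonglongrightarrow> u_inf"
proof (rule Lim_transform_eventually)
  have "filterlim (\<lambda>N. nat (int N + r)) at_top sequentially"
    unfolding filterlim_at_top
  proof
    fix Z
    show "eventually (\<lambda>N. Z \<le> nat (int N + r)) sequentially"
      using eventually_ge_at_top[of "Z + nat \<bar>r\<bar>"] by eventually_elim linarith
  qed
  then show "(\<lambda>N. u (nat (int N + r))) \<longlonglongrightarrow> u_inf"
    by (rule filterlim_compose[OF u_lim])
  show "eventually (\<lambda>N. u (nat (int N + r)) = rqpoch (int N + r)) sequentially"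
    using eventually_ge_at_top[of "nat \<bar>r\<bar>"] by eventually_elim (simp add: rqpoch_def)
qed

lemma tendsto_rqpoch_diff: "(\<lambda>N. rqpoch (int N - r)) \<longlonglongrightarrow> u_inf"
  using tendsto_rqpoch_add[of "-r"] by simp

definition theta :: "int \<Rightarrow> 'a" where
  "theta k = q ^ nat (15*k^2 + k) - q ^ nat (15*k^2 + 11*k + 2)"

lemma tendsto_theta_term: "(\<lambda>N. theta_term N k) \<longlonglongrightarrow> u_inf * u_inf * theta k"
proof -
  have "(\<lambda>N. theta_term N k) \<longlonglongrightarrow>
      qpow (15*k^2 + k) * (u_inf * u_inf) - qpow (15*k^2 + 11*k + 2) * (u_inf * u_inf)"
    unfolding theta_term_def by (intro tendsto_intros tendsto_rqpoch_add tendsto_rqpoch_diff)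
  then show ?thesis by (simp add: theta_def qpow_def algebra_simps)
qed

text \<open>The predicate \<open>dominated\<close> stands for whatever hypothesis makes Tannery's
  theorem true in the ring at hand. The two sides of \<open>finite_identity\<close> tend to u_inf
  times the wanted series and to u_inf^2 times the theta sum; one factor u_inf is then
  cancelled.\<close>

lemma identity_of_tannery:
  assumes tannery: "\<And>F L. (\<And>n. (\<lambda>N. F N n) \<longlonglongrightarrow> L n) \<Longrightarrow> dominated F \<Longrightarrow>
      \<exists>s. L sums s \<and> (\<lambda>N. \<Sum>n\<le>N. F N n) \<longlonglongrightarrow> s"
    and dom1: "dominated (\<lambda>N n. q ^ (n^2) * rqpoch (int N - int n) * rqpoch (2 * int n))"
    and dom2: "dominated (\<lambda>N j. \<Sum>k\<in>{int j, -int j}. theta_term N k)"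
    and theta: "theta summable_on UNIV"
  shows "(\<lambda>n. q ^ (n^2) * u (2*n)) sums (u_inf * infsum theta UNIV)"
proof -
  have "(\<lambda>N. q ^ (n^2) * rqpoch (int N - int n) * rqpoch (2 * int n)) \<longlonglongrightarrow> u_inf * (q ^ (n^2) * u (2*n))" for n
  proof -
    have "(\<lambda>N. q ^ (n^2) * rqpoch (int N - int n) * rqpoch (2 * int n)) \<longlonglongrightarrow> q ^ (n^2) * u_inf * rqpoch (2 * int n)"
      by (intro tendsto_intros tendsto_rqpoch_diff)
    then show ?thesis
      using rqpoch_of_nat[of "2*n"] by (simp add: mult_ac)
  qed
  from tannery[OF this dom1] obtain s where
    s: "(\<lambda>n. u_inf * (q ^ (n^2) * u (2*n))) sums s"
    and "(\<lambda>N. \<Sum>n\<le>N. q ^ (n^2) * rqpoch (int N - int n) * rqpoch (2 * int n)) \<longlonglongrightarrow> s"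
    by blast
  then have lim_s: "(\<lambda>N. \<Sum>k=-int N..int N. theta_term N k) \<longlonglongrightarrow> s"
    by (simp only: finite_identity)
  have "(\<lambda>N. \<Sum>k\<in>{int j, -int j}. theta_term N k)
      \<longlonglongrightarrow> (\<Sum>k\<in>{int j, -int j}. u_inf * u_inf * theta k)" for j
    by (intro tendsto_sum tendsto_theta_term)
  from tannery[OF this dom2] obtain t where
    t: "(\<lambda>j. \<Sum>k\<in>{int j, -int j}. u_inf * u_inf * theta k) sums t"
    and lim_t: "(\<lambda>N. \<Sum>k=-int N..int N. theta_term N k) \<longlonglongrightarrow> t"
    unfolding sum_symmetric_interval by blast
  have "(\<lambda>N. \<Sum>k=-int N..int N. u_inf * u_inf * theta k) \<longlonglongrightarrow> t"
    using t by (simp only: sums_def_le sum_symmetric_interval)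
  moreover have "(\<lambda>N. \<Sum>k=-int N..int N. u_inf * u_inf * theta k) \<longlonglongrightarrow> u_inf * u_inf * infsum theta UNIV"
    unfolding sum_distrib_left[symmetric] by (intro tendsto_intros sums_symmetric_infsum theta)
  ultimately have "s = u_inf * u_inf * infsum theta UNIV"
    using LIMSEQ_unique lim_s lim_t by metis
  \<comment> \<open>Multiplying by (q;q)_inf, the inverse of u_inf, removes the surplus
    factor.\<close>
  moreover have "(\<lambda>n. qpoch_inf q * (u_inf * (q ^ (n^2) * u (2*n)))) sums (qpoch_inf q * s)"
    using s unfolding sums_def sum_distrib_left[symmetric] by (intro tendsto_intros)
  ultimately show ?thesis
    by (simp add: mult.assoc[symmetric] qpoch_inf_mult_u_inf)
qed

end

section \<open>The case of formal power series\<close>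

lemma qpoch_fps_nth_0 [simp]: "fps_nth (qpoch (fps_X :: 'a::field fps) n) 0 = 1"
  by (induction n) (simp_all add: qpoch_def)

lemma tendsto_qpoch_fps: "qpoch (fps_X :: 'a::field fps) \<longlonglongrightarrow> qpoch_inf fps_X"
proof (rule tendsto_qpoch[OF convergent_prod_qpoch_inf_fps])
  have "fps_nth (1 - (fps_X :: 'a fps) ^ Suc j) 0 = 1" for j
    by simp
  then show "1 - (fps_X :: 'a fps) ^ Suc j \<noteq> 0" for j
    by (metis fps_zero_nth zero_neq_one)
qed

lemma qpoch_inf_fps_nth_0: "fps_nth (qpoch_inf (fps_X :: 'a::field fps)) 0 = 1"
proof -
  have "eventually (\<lambda>n. fps_nth (qpoch (fps_X :: 'a fps) n) 0 = fps_nth (qpoch_inf fps_X) 0) sequentially"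
    using tendsto_qpoch_fps unfolding tendsto_fps_iff by blast
  then show ?thesis by (auto simp: eventually_sequentially)
qed

lemma theta_identity_fps:
  "(\<lambda>n. fps_X ^ (n^2) / qpoch (fps_X :: 'a::field fps) (2*n)) sums
     (1 / qpoch_inf fps_X *
       (\<Sum>\<^sub>\<infinity>k::int. fps_X ^ nat (15*k^2 + k) - fps_X ^ nat (15*k^2 + 11*k + 2)))"
proof -
  interpret qpoch_inverse_limit "fps_X :: 'a fps" "\<lambda>n. inverse (qpoch fps_X n)" "inverse (qpoch_inf fps_X)"
  proof
    show "qpoch (fps_X :: 'a fps) n * inverse (qpoch fps_X n) = 1" for n
      by (rule inverse_mult_eq_1') simp
    show "(\<lambda>n. inverse (qpoch (fps_X :: 'a fps) n)) \<longlonglongrightarrow> inverse (qpoch_inf fps_X)"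
      by (intro tendsto_inverse_fps tendsto_qpoch_fps)
         (simp add: qpoch_inf_fps_nth_0)
  qed (rule convergent_prod_qpoch_inf_fps)
  have le_square: "n \<le> n^2" for n :: nat
    by (simp add: power2_eq_square)
  have "(\<lambda>n. fps_X ^ (n^2) * inverse (qpoch (fps_X :: 'a fps) (2*n))) sums
      (inverse (qpoch_inf fps_X) * infsum theta UNIV)"
  proof (rule identity_of_tannery)
    \<comment> \<open>Here \<open>dominated F\<close> means that X^n divides F N n for all N and
      n.\<close>
    show "\<exists>s. L sums s \<and> (\<lambda>N. \<Sum>n\<le>N. F N n) \<longlonglongrightarrow> s"
      if "\<And>n. (\<lambda>N. F N n) \<longlonglongrightarrow> L n" "\<forall>N n. \<forall>i<n. fps_nth (F N n) i = 0"
      for F and L :: "nat \<Rightarrow> 'a fps"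
      using that by (intro tannery_fps) auto
    show "\<forall>N n. \<forall>i<n. fps_nth (fps_X ^ (n^2) * rqpoch (int N - int n) * rqpoch (2 * int n)) i = 0"
      using le_square by (auto simp: mult.assoc fps_X_power_mult_nth dest: order.strict_trans2)
    show "\<forall>N n. \<forall>i<n. fps_nth (\<Sum>k\<in>{int n, -int n}. theta_term N k) i = 0"
    proof (intro allI impI)
      fix N n i :: nat
      assume "i < n"
      have "fps_nth (theta_term N k) i = 0" if "k \<in> {int n, -int n}" for k
      proof -
        have "\<bar>k\<bar> = int n"
          using that by auto
        then have "i < nat (15*k^2 + k)" "i < nat (15*k^2 + 11*k + 2)"
          using theta_exponents_bound[of k] \<open>i < n\<close> by linarith+
        then show ?thesis
          by (simp add: theta_term_def qpow_def fps_X_power_mult_nth)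
      qed
      then show "fps_nth (\<Sum>k\<in>{int n, -int n}. theta_term N k) i = 0"
        by (simp add: fps_sum_nth)
    qed
    show "theta summable_on UNIV"
      unfolding theta_def by (rule summable_on_theta_fps)
  qed
  then show ?thesis
    by (simp add: fps_divide_unit qpoch_inf_fps_nth_0 theta_def[abs_def])
qed

section \<open>The case of complex q in the unit disc\<close>

lemma theta_identity_complex:
  fixes q :: complex
  assumes q: "norm q < 1"
  shows "(\<lambda>n. q ^ (n^2) / qpoch q (2*n)) sums
     (1 / qpoch_inf q * (\<Sum>\<^sub>\<infinity>k::int. q ^ nat (15*k^2 + k) - q ^ nat (15*k^2 + 11*k + 2)))"
proof -
  have factor_nonzero: "1 - q ^ Suc j \<noteq> 0" for j
  proof
    assume "1 - q ^ Suc j = 0"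
    then have "norm q ^ Suc j = 1"
      by (metis eq_iff_diff_eq_0 norm_one norm_power)
    then show False
      using power_Suc_less_one[of "norm q" j] q by (cases "q = 0") auto
  qed
  have qpoch_nonzero: "qpoch q n \<noteq> 0" for n
    unfolding qpoch_def using factor_nonzero by (auto simp: Suc_le_eq gr0_conv_Suc simp del: power_Suc)
  have lim: "qpoch q \<longlonglongrightarrow> qpoch_inf q"
    by (intro tendsto_qpoch convergent_prod_qpoch_inf_complex q factor_nonzero)
  have qpoch_inf_nonzero: "qpoch_inf q \<noteq> 0"
    unfolding qpoch_inf_def
    using prodinf_nonzero[OF convergent_prod_qpoch_inf_complex[OF q]] factor_nonzero by blast
  interpret qpoch_inverse_limit q "\<lambda>n. inverse (qpoch q n)" "inverse (qpoch_inf q)"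
    by unfold_locales
      (use qpoch_nonzero qpoch_inf_nonzero lim convergent_prod_qpoch_inf_complex[OF q]
        in \<open>auto intro!: tendsto_inverse\<close>)
  \<comment> \<open>The inverse q-factorials converge, hence are bounded; this gives a majorant
    independent of N.\<close>
  obtain C where C: "\<And>n. norm (inverse (qpoch q n)) \<le> C"
    using convergent_imp_Bseq[OF convergentI[OF u_lim]] by (auto simp: Bseq_def)
  have "C \<ge> 0"
    using C[of 0] norm_ge_zero order_trans by blast
  have rqpoch_le: "norm (rqpoch m) \<le> C" for m
    using C \<open>C \<ge> 0\<close> by (simp add: rqpoch_def)
  have monomial_le: "norm (q ^ e * (rqpoch a * rqpoch b)) \<le> norm q ^ d * (C * C)" if "d \<le> e" for d e a b
    unfolding norm_mult norm_power using q that rqpoch_le \<open>C \<ge> 0\<close>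
    by (intro mult_mono power_decreasing) auto
  have theta_term_le: "norm (theta_term N k) \<le> 2 * (norm q ^ nat \<bar>k\<bar> * (C * C))" for N k
  proof -
    have "norm (theta_term N k) \<le> norm q ^ nat \<bar>k\<bar> * (C * C) + norm q ^ nat \<bar>k\<bar> * (C * C)"
      unfolding theta_term_def qpow_def
      using theta_exponents_bound[of k]
      by (intro order_trans[OF norm_triangle_ineq4] add_mono monomial_le) auto
    then show ?thesis by (simp only: mult_2)
  qed
  \<comment> \<open>The factor 4 counts at most two indices k = n and k = -n, each contributing two
    monomials bounded by |q|^n C^2.\<close>
  let ?M = "\<lambda>n. 4 * (norm q ^ n * (C * C))"
  have "summable ?M"
    using q by (intro summable_mult summable_mult2 summable_geometric) auto
  have "(\<lambda>n. q ^ (n^2) * inverse (qpoch q (2*n))) sums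
      (inverse (qpoch_inf q) * infsum theta UNIV)"
  proof (rule identity_of_tannery)
    show "\<exists>s. L sums s \<and> (\<lambda>N. \<Sum>n\<le>N. F N n) \<longlonglongrightarrow> s"
      if "\<And>n. (\<lambda>N. F N n) \<longlonglongrightarrow> L n" "\<forall>N n. norm (F N n) \<le> ?M n"
      for F and L :: "nat \<Rightarrow> complex"
      using that \<open>summable ?M\<close> by (intro tannery_banach[where M = ?M]) auto
    show "\<forall>N n. norm (q ^ (n^2) * rqpoch (int N - int n) * rqpoch (2 * int n)) \<le> ?M n"
    proof (intro allI)
      fix N n :: nat
      have "norm (q ^ (n^2) * rqpoch (int N - int n) * rqpoch (2 * int n)) \<le> norm q ^ n * (C * C)"
        unfolding mult.assoc by (rule monomial_le) (simp add: power2_eq_square)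
      also have "\<dots> \<le> ?M n"
        using \<open>C \<ge> 0\<close> by simp
      finally show "norm (q ^ (n^2) * rqpoch (int N - int n) * rqpoch (2 * int n)) \<le> ?M n" .
    qed
    show "\<forall>N n. norm (\<Sum>k\<in>{int n, -int n}. theta_term N k) \<le> ?M n"
    proof (intro allI)
      fix N n :: nat
      have "norm (\<Sum>k\<in>{int n, -int n}. theta_term N k)
          \<le> of_nat (card {int n, -int n}) * (2 * (norm q ^ n * (C * C)))"
      proof (rule order_trans[OF norm_sum sum_bounded_above])
        show "norm (theta_term N k) \<le> 2 * (norm q ^ n * (C * C))" if "k \<in> {int n, -int n}" for k
          using theta_term_le[of N k] that by auto
      qed
      also have "\<dots> \<le> 2 * (2 * (norm q ^ n * (C * C)))"
        using \<open>C \<ge> 0\<close> by (intro mult_right_mono) (auto simp: card_insert_if)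
      finally show "norm (\<Sum>k\<in>{int n, -int n}. theta_term N k) \<le> ?M n" by simp
    qed
    show "theta summable_on UNIV"
      unfolding theta_def by (rule summable_on_theta_complex[OF q])
  qed
  then show ?thesis
    by (simp add: divide_inverse theta_def[abs_def])
qed

theorem corollary5p1:
  shows "((\<lambda>n. fps_X ^ (n^2) / qpoch (fps_X :: 'a::field fps) (2*n)) sums
           (1 / qpoch_inf fps_X *
             (\<Sum>\<^sub>\<infinity>k::int. fps_X ^ nat (15*k^2 + k) - fps_X ^ nat (15*k^2 + 11*k + 2)))) \<and>
         (\<forall>q::complex. norm q < 1 \<longrightarrow>
          (\<lambda>n. q ^ (n^2) / qpoch q (2*n)) sums
            (1 / qpoch_inf q *
              (\<Sum>\<^sub>\<infinity>k::int. q ^ nat (15*k^2 + k) - q ^ nat (15*k^2 + 11*k + 2))))"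
  using theta_identity_fps theta_identity_complex by blast

end
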